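(* Let $d\ge1$ and let $f:\mathbb R^d\to[-1,1]$ be an odd measurable function. For every finitely supported probability distribution $\mathcal D$ on $P$ there is a finitely supported probability distribution $\mathcal D'$ on $P$ with $c(\mathcal D')=c(\mathcal D)$ and $s_3(f,\mathcal D')\le s_3(f,\mathcal D)$ that has one of the following forms: (1) $\mathcal D'$ is supported on $\{(-\rho,-\rho,-\rho),(-\rho,-\rho,1)\}$ for some $\rho\in[0,\tfrac13]$; (2) $\mathcal D'$ is supported on $\{(-\tfrac13,-\tfrac13,-\tfrac13),(-\rho,-\rho,1)\}$ for some $\rho\in[\tfrac13,1]$; (3) $\mathcal D'$ is supported on $\{(-\rho,-\rho,1),(1,1,1)\}$ for some $\rho\in[-1,1]$. (That is, for MAX NAE-$\{3\}$-SAT with any completeness, the hardest distributions of pairwise biases for one-dimensional or multidimensional odd RPR$^2$ rounding are of these forms.)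
   Context: $P\subseteq\mathbb R^3$ is the set of triples $(b_{1,2},b_{1,3},b_{2,3})$ of pairwise biases $\mathbb E[x_1x_2],\mathbb E[x_1x_3],\mathbb E[x_2x_3]$ realizable by some distribution on $(x_1,x_2,x_3)\in\{-1,1\}^3$; equivalently $b_{1,2}+b_{1,3}+b_{2,3}\ge-1$, $b_{1,2}\ge b_{1,3}+b_{2,3}-1$, $b_{1,3}\ge b_{1,2}+b_{2,3}-1$, $b_{2,3}\ge b_{1,2}+b_{1,3}-1$. For a distribution $\mathcal D$ on $P$ (the distribution of the pairwise biases of the clauses of an $\mathrm{NAE}_3$ instance), its completeness is $c(\mathcal D)=\mathbb E_{\mathcal D}\big[\frac{3-b_{1,2}-b_{1,3}-b_{2,3}}{4}\big]$ and the performance of $f$ is $s_3(f,\mathcal D)=\mathbb E_{\mathcal D}\big[\frac{3-F_2[f](b_{1,2})-F_2[f](b_{1,3})-F_2[f](b_{2,3})}{4}\big]$. Here $F_2[f](\rho)=\mathbb E[f(\mathbf g)f(\mathbf h)]$ where $\mathbf g,\mathbf h$ are $d$-dimensional standard Gaussian vectors with $\mathbb E[g_ih_j]=\rho\,\delta_{ij}$ (i.e. $\rho$-correlated), which equals $\mathbb E[X_1X_2]$ for the RPR$^2$ rounding with $f$ of two unit vectors with inner product $\rho$. *)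

theory Defs
  imports "HOL-Probability.Probability"
begin

type_synonym triple = "real \<times> real \<times> real"

text \<open>The polytope P of realizable pairwise biases (b12, b13, b23).\<close>
definition biasP :: "triple set" where
  "biasP = {(b12, b13, b23). b12 + b13 + b23 \<ge> -1 \<and> b12 \<ge> b13 + b23 - 1
       \<and> b13 \<ge> b12 + b23 - 1 \<and> b23 \<ge> b12 + b13 - 1}"

definition std_gauss :: "(real ^ 'd::finite) measure" where
  "std_gauss = density lborel (\<lambda>x. ennreal (\<Prod>i\<in>UNIV. std_normal_density (x $ i)))"

text \<open>F2[f](rho) = E[f(g) f(h)] for rho-correlated standard Gaussian vectors g, h:
  h = rho g + sqrt(1 - rho^2) z with g, z independent standard Gaussians.\<close>
definition F2 :: "(real ^ 'd::finite \<Rightarrow> real) \<Rightarrow> real \<Rightarrow> real" where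
  "F2 f \<rho> = (\<integral>p. f (fst p) * f (\<rho> *\<^sub>R fst p + sqrt (1 - \<rho>\<^sup>2) *\<^sub>R snd p)
                 \<partial>(std_gauss \<Otimes>\<^sub>M std_gauss))"

definition completeness :: "triple pmf \<Rightarrow> real" where
  "completeness D = measure_pmf.expectation D (\<lambda>(a, b, c). (3 - a - b - c) / 4)"

definition s3 :: "(real ^ 'd::finite \<Rightarrow> real) \<Rightarrow> triple pmf \<Rightarrow> real" where
  "s3 f D = measure_pmf.expectation D
      (\<lambda>(a, b, c). (3 - F2 f a - F2 f b - F2 f c) / 4)"

definition fin_dist_on_P :: "triple pmf \<Rightarrow> bool" where
  "fin_dist_on_P D \<longleftrightarrow> finite (set_pmf D) \<and> set_pmf D \<subseteq> biasP"

end

theory Submission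
  imports Defs "HOL-Real_Asymp.Real_Asymp"
begin

text \<open>
  The function \<open>F = F2 f\<close> is odd and convex on \<open>[0, 1]\<close>, and nothing else about \<open>f\<close> matters.

  Convexity: if \<open>f\<close> is a trigonometric sum \<open>\<Sum>j. c j * exp (i u j \<bullet> x)\<close>, then
  \<open>F \<rho> = \<Sum>j l. z j * cnj (z l) * exp (\<rho> (u j \<bullet> u l))\<close> with \<open>z j = c j * exp (- \<bar>u j\<bar>^2 / 2)\<close>, a power series in
  \<open>\<rho>\<close> with nonnegative coefficients because the kernels \<open>(u j \<bullet> u l) ^ k\<close> are positive semidefinite.
  A polynomial in the coordinates \<open>R sin (x b / R)\<close> is such a sum, so by Stone-Weierstrass bounded
  continuous functions, and then bounded measurable ones, are bounded almost-everywhere limits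
  of functions for which convexity holds.

  Optimisation: for a fixed bias sum \<open>t\<close>, the value \<open>F b12 + F b13 + F b23\<close> is largest at
  \<open>(t/3, t/3, t/3)\<close> or at \<open>(-r, -r, 1)\<close> with \<open>r = (1 - t)/2\<close>. Hence the pair of expected bias sum and
  expected value is dominated by a mixture of one point \<open>(-r1, -r1, -r1)\<close>, one point \<open>(-r2, -r2, 1)\<close> and
  \<open>(1, 1, 1)\<close>; Jensen's inequality makes \<open>r1\<close> and \<open>r2\<close> equal (or moves \<open>r1\<close> up to its largest value
  1/3), and one of the three points can be removed by shifting weight.
\<close>

section \<open>Convexity and oddness of F2\<close>

lemma prod_Basis_vec: "(\<Prod>b\<in>Basis. g (x \<bullet> b)) = (\<Prod>i\<in>UNIV. g (x $ i))" for x :: "real ^ 'd::finite"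
proof -
  have B: "(Basis :: (real ^ 'd) set) = range (\<lambda>i. axis i 1)"
    by (auto simp: Basis_vec_def)
  have "inj (\<lambda>i. axis i 1 :: real ^ 'd)"
    by (auto simp: inj_on_def axis_eq_axis)
  then show ?thesis
    unfolding B by (simp add: prod.reindex inner_axis)
qed

text \<open>\<open>lborel\<close> is the image of a product of one-dimensional Lebesgue measures
  under the map that assembles a vector from its coordinates, so Fubini for finite products
  applies.\<close>

lemma integral_lborel_prod_Basis:
  fixes f :: "'a::euclidean_space \<Rightarrow> real \<Rightarrow> 'b::{real_normed_field, banach, second_countable_topology}"
  assumes "\<And>b. b \<in> Basis \<Longrightarrow> integrable lborel (f b)"
  shows "(\<integral>x. (\<Prod>b\<in>Basis. f b (x \<bullet> b)) \<partial>lborel) = (\<Prod>b\<in>Basis. (\<integral>t. f b t \<partial>lborel))"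
proof -
  interpret product_sigma_finite "\<lambda>b::'a. lborel :: real measure"
    by standard
  have [measurable]: "f b \<in> borel_measurable borel" if "b \<in> Basis" for b
    using borel_measurable_integrable[OF assms[OF that]] by simp
  have "(\<integral>x. (\<Prod>b\<in>Basis. f b (x \<bullet> b)) \<partial>lborel)
     = (\<integral>y. (\<Prod>b\<in>Basis. f b ((\<Sum>b\<in>Basis. y b *\<^sub>R b) \<bullet> b)) \<partial>(\<Pi>\<^sub>M b\<in>Basis. lborel))"
    by (subst lborel_eq, subst integral_distr) simp_all
  also have "\<dots> = (\<integral>y. (\<Prod>b\<in>Basis. f b (y b)) \<partial>(\<Pi>\<^sub>M b\<in>Basis. lborel))"
    by (intro Bochner_Integration.integral_cong refl prod.cong) simp
  also have "\<dots> = (\<Prod>b\<in>Basis. (\<integral>t. f b t \<partial>lborel))"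
    by (rule product_integral_prod) (use assms in auto)
  finally show ?thesis .
qed

lemma sets_std_gauss [measurable_cong, simp]: "sets std_gauss = sets borel"
  and space_std_gauss [simp]: "space std_gauss = UNIV"
  by (simp_all add: std_gauss_def)

lemma std_gauss_density_measurable [measurable]:
  "(\<lambda>x. \<Prod>i\<in>UNIV. std_normal_density (x $ i)) \<in> borel_measurable (borel :: (real ^ 'd::finite) measure)"
  unfolding prod_Basis_vec[symmetric] by measurable

lemma prob_space_std_gauss: "prob_space (std_gauss :: (real ^ 'd::finite) measure)"
proof
  have "emeasure (std_gauss :: (real ^ 'd) measure) UNIV
      = (\<integral>\<^sup>+x. (\<Prod>b\<in>Basis. ennreal (std_normal_density (x \<bullet> b))) \<partial>(lborel :: (real ^ 'd) measure))"
    unfolding std_gauss_def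
    by (subst emeasure_density) (simp_all add: prod_ennreal prod_Basis_vec)
  also have "\<dots> = (\<Prod>b\<in>(Basis :: (real ^ 'd) set). \<integral>\<^sup>+t. ennreal (std_normal_density t) \<partial>lborel)"
    by (rule nn_integral_lborel_prod) auto
  also have "(\<integral>\<^sup>+t. ennreal (std_normal_density t) \<partial>lborel) = 1"
    by (subst nn_integral_eq_integral) auto
  finally show "emeasure (std_gauss :: (real ^ 'd) measure) (space std_gauss) = 1" by simp
qed

interpretation std_gauss: prob_space "std_gauss :: (real ^ 'd::finite) measure"
  by (rule prob_space_std_gauss)

interpretation std_gauss_pair: pair_prob_space "std_gauss :: (real ^ 'd::finite) measure" "std_gauss :: (real ^ 'd::finite) measure"
  by standard

lemma integral_std_gauss:
  fixes h :: "real ^ 'd::finite \<Rightarrow> 'b::{banach, second_countable_topology}"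
  assumes "h \<in> borel_measurable borel"
  shows "(\<integral>x. h x \<partial>std_gauss) = (\<integral>x. (\<Prod>i\<in>UNIV. std_normal_density (x $ i)) *\<^sub>R h x \<partial>lborel)"
  unfolding std_gauss_def by (rule integral_density) (simp_all add: assms prod_nonneg)

text \<open>Both the density and \<open>iexp (w \<bullet> x)\<close> factor over the coordinates,
  which reduces the claim to the characteristic function of the one-dimensional normal
  distribution.\<close>

lemma char_std_gauss:
  fixes w :: "real ^ 'd::finite"
  shows "(\<integral>x. iexp (w \<bullet> x) \<partial>std_gauss) = of_real (exp (- (norm w)\<^sup>2 / 2))"
proof -
  have char1: "(\<integral>t. std_normal_density t *\<^sub>R iexp (s * t) \<partial>lborel) = of_real (exp (- s\<^sup>2 / 2))" for s
    using fun_cong[OF char_std_normal_distribution, of s]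
    by (simp add: char_def integral_density)
  have int1: "integrable lborel (\<lambda>t. std_normal_density t *\<^sub>R iexp (s * t))" for s
    by (rule Bochner_Integration.integrable_bound[of _ std_normal_density]) auto
  have "(\<integral>x. iexp (w \<bullet> x) \<partial>std_gauss)
      = (\<integral>x. (\<Prod>i\<in>UNIV. std_normal_density (x $ i)) *\<^sub>R iexp (w \<bullet> x) \<partial>lborel)"
    by (intro integral_std_gauss borel_measurable_continuous_onI continuous_intros)
  also have "\<dots> = (\<integral>x. (\<Prod>b\<in>Basis. std_normal_density (x \<bullet> b) *\<^sub>R iexp ((w \<bullet> b) * (x \<bullet> b))) \<partial>lborel)"
    unfolding prod_Basis_vec[symmetric]
  proof (intro Bochner_Integration.integral_cong refl)
    fix x :: "real ^ 'd"
    have "iexp (w \<bullet> x) = (\<Prod>b\<in>Basis. iexp ((w \<bullet> b) * (x \<bullet> b)))"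
      by (subst euclidean_inner) (simp add: exp_sum sum_distrib_left)
    then show "(\<Prod>b\<in>Basis. std_normal_density (x \<bullet> b)) *\<^sub>R iexp (w \<bullet> x)
        = (\<Prod>b\<in>Basis. std_normal_density (x \<bullet> b) *\<^sub>R iexp ((w \<bullet> b) * (x \<bullet> b)))"
      by (simp add: scaleR_conv_of_real prod.distrib)
  qed
  also have "\<dots> = (\<Prod>b\<in>Basis. of_real (exp (- (w \<bullet> b)\<^sup>2 / 2)))"
    by (subst integral_lborel_prod_Basis[where f = "\<lambda>b t. std_normal_density t *\<^sub>R iexp ((w \<bullet> b) * t)"])
      (simp_all only: char1 int1)
  also have "\<dots> = of_real (exp (\<Sum>b\<in>Basis. - (w \<bullet> b)\<^sup>2 / 2))"
    by (simp add: exp_sum)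
  also have "(\<Sum>b\<in>Basis. - (w \<bullet> b)\<^sup>2 / 2) = - (norm w)\<^sup>2 / 2"
    unfolding power2_norm_eq_inner
    by (subst (2) euclidean_inner) (simp add: power2_eq_square sum_negf sum_divide_distrib)
  finally show ?thesis .
qed

lemma integral_std_gauss_uminus:
  fixes h :: "real ^ 'd::finite \<Rightarrow> real"
  assumes [measurable]: "h \<in> borel_measurable borel"
  shows "(\<integral>z. h (- z) \<partial>std_gauss) = (\<integral>z. h z \<partial>std_gauss)"
proof -
  \<comment> \<open>Reflection is the affine map with factor -1; its Jacobian has absolute value 1
    in every dimension.\<close>
  have lb: "(lborel :: (real ^ 'd) measure) = distr lborel borel uminus"
    using lborel_affine[of "-1" "0 :: real ^ 'd"] by (simp add: density_1)
  have "(\<integral>z. h z \<partial>std_gauss) = (\<integral>z. (\<Prod>i\<in>UNIV. std_normal_density (z $ i)) *\<^sub>R h z \<partial>lborel)"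
    by (rule integral_std_gauss) measurable
  also have "\<dots> = (\<integral>z. (\<Prod>i\<in>UNIV. std_normal_density ((- z) $ i)) *\<^sub>R h (- z) \<partial>lborel)"
    by (subst lb, subst integral_distr) auto
  also have "\<dots> = (\<integral>z. h (- z) \<partial>std_gauss)"
    by (subst integral_std_gauss) (simp_all add: normal_density_def)
  finally show ?thesis by simp
qed

text \<open>Replacing \<open>z\<close> by \<open>- z\<close> preserves the Gaussian measure and
  turns the second argument into \<open>- (\<rho> *\<^sub>R x + s *\<^sub>R z)\<close>; oddness of
  \<open>f\<close> then pulls the sign out. Boundedness gives the integrability behind
  Fubini.\<close>

lemma F2_uminus:
  fixes f :: "real ^ 'd::finite \<Rightarrow> real"
  assumes [measurable]: "f \<in> borel_measurable borel"
    and bound: "\<And>x. \<bar>f x\<bar> \<le> C" and odd: "\<And>x. f (- x) = - f x"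
  shows "F2 f (- \<rho>) = - F2 f \<rho>"
proof -
  have int: "integrable (std_gauss \<Otimes>\<^sub>M std_gauss)
      (\<lambda>p. f (fst p) * f (r *\<^sub>R fst p + s *\<^sub>R snd p))" for r s
    by (rule std_gauss_pair.P.integrable_const_bound[of _ "C * C"])
      (auto simp: abs_mult intro!: mult_mono bound AE_I2 order_trans[OF abs_ge_zero bound])
  define s where "s = sqrt (1 - \<rho>\<^sup>2)"
  have "F2 f (- \<rho>) = (\<integral>x. \<integral>z. f x * f ((- \<rho>) *\<^sub>R x + s *\<^sub>R z) \<partial>std_gauss \<partial>std_gauss)"
    unfolding F2_def s_def by (subst std_gauss_pair.integral_fst'[OF int, symmetric]) simp
  also have "\<dots> = (\<integral>x. \<integral>z. f x * f ((- \<rho>) *\<^sub>R x + s *\<^sub>R (- z)) \<partial>std_gauss \<partial>std_gauss)"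
    by (subst (2) integral_std_gauss_uminus[symmetric]) auto
  also have "\<dots> = (\<integral>x. \<integral>z. - (f x * f (\<rho> *\<^sub>R x + s *\<^sub>R z)) \<partial>std_gauss \<partial>std_gauss)"
  proof -
    have "(- \<rho>) *\<^sub>R x + s *\<^sub>R (- z) = - (\<rho> *\<^sub>R x + s *\<^sub>R z)" for x z :: "real ^ 'd"
      by simp
    then show ?thesis by (simp only: odd mult_minus_right)
  qed
  also have "\<dots> = - (\<integral>x. \<integral>z. f x * f (\<rho> *\<^sub>R x + s *\<^sub>R z) \<partial>std_gauss \<partial>std_gauss)"
    by simp
  also have "\<dots> = - F2 f \<rho>"
    unfolding F2_def s_def by (subst std_gauss_pair.integral_fst'[OF int, symmetric]) simp
  finally show ?thesis .
qed

section \<open>Stability of \<open>F2\<close> and of its convexity under bounded almost-everywhere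
  limits\<close>

lemma AE_std_gauss:
  assumes "AE x in lborel. P x"
  shows "AE x in std_gauss. P (x :: real ^ 'd::finite)"
  unfolding std_gauss_def by (subst AE_density) (use assms in auto)

text \<open>A translation combined with a nonzero scaling changes Lebesgue measure only by a
  constant factor, so it preserves null sets.\<close>

lemma AE_lborel_affine:
  fixes a :: "'a::euclidean_space"
  assumes N: "N \<in> null_sets lborel" and s: "s \<noteq> 0"
  shows "AE z in lborel. a + s *\<^sub>R z \<notin> N"
proof -
  have [measurable]: "N \<in> sets borel" using N by auto
  have "AE x in lborel. x \<notin> N" using N by (rule AE_not_in)
  then have "AE x in density (distr lborel borel (\<lambda>x. a + s *\<^sub>R x)) (\<lambda>_. \<bar>s\<bar> ^ DIM('a)). x \<notin> N"
    using lborel_affine[OF s, of a] by metis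
  then show ?thesis using s by (simp add: AE_density AE_distr_iff)
qed

text \<open>Dominated convergence with bound \<open>C * C\<close>. Both correlated arguments must
  avoid the exceptional null set: for fixed \<open>x\<close> the second one is an affine image of
  \<open>z\<close> with factor \<open>s\<close>, nonzero unless \<open>\<rho> = 1\<close>, and for
  \<open>\<rho> = 1\<close> it is \<open>x\<close> itself.\<close>

lemma F2_tendsto:
  fixes f :: "real ^ 'd::finite \<Rightarrow> real"
  assumes [measurable]: "\<And>n. g n \<in> borel_measurable borel" "f \<in> borel_measurable borel"
    and bound: "\<And>n x. \<bar>g n x\<bar> \<le> C" and lim: "AE x in lborel. (\<lambda>n. g n x) \<longlonglongrightarrow> f x"
    and \<rho>: "\<rho> \<in> {0..1}"
  shows "(\<lambda>n. F2 (g n) \<rho>) \<longlonglongrightarrow> F2 f \<rho>"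
proof -
  obtain N where N: "{x \<in> space lborel. \<not> (\<lambda>n. g n x) \<longlonglongrightarrow> f x} \<subseteq> N" "N \<in> null_sets lborel"
    using lim by (auto elim!: AE_E simp: null_sets_def)
  then have [measurable]: "N \<in> sets borel" by auto
  have lim': "(\<lambda>n. g n x) \<longlonglongrightarrow> f x" if "x \<notin> N" for x using that N by auto
  define s where "s = sqrt (1 - \<rho>\<^sup>2)"
  have NN: "AE x in std_gauss. x \<notin> N" using N(2) by (intro AE_std_gauss AE_not_in)
  have "AE x in std_gauss. AE z in std_gauss. \<rho> *\<^sub>R x + s *\<^sub>R z \<notin> N"
  proof (cases "\<rho> = 1")
    case True
    then show ?thesis using NN by (simp add: s_def)
  next
    case False
    then have "s \<noteq> 0" using \<rho> power_mono[of \<rho> 1 2] by (auto simp: s_def power2_eq_1_iff)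
    then show ?thesis using N(2) by (intro AE_I2 AE_std_gauss AE_lborel_affine)
  qed
  then have ae: "AE x in std_gauss. AE z in std_gauss.
      fst (x, z) \<notin> N \<and> \<rho> *\<^sub>R fst (x, z) + s *\<^sub>R snd (x, z) \<notin> N"
    using NN by eventually_elim (auto elim: eventually_mono)
  have "{p \<in> space (std_gauss \<Otimes>\<^sub>M std_gauss). fst p \<notin> N \<and> \<rho> *\<^sub>R fst p + s *\<^sub>R snd p \<notin> N}
      \<in> sets (std_gauss \<Otimes>\<^sub>M std_gauss)"
    by measurable
  then have "AE p in std_gauss \<Otimes>\<^sub>M std_gauss. fst p \<notin> N \<and> \<rho> *\<^sub>R fst p + s *\<^sub>R snd p \<notin> N"
    by (rule std_gauss_pair.AE_pair_measure[OF _ ae])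
  then have "AE p in std_gauss \<Otimes>\<^sub>M std_gauss.
      (\<lambda>n. g n (fst p) * g n (\<rho> *\<^sub>R fst p + s *\<^sub>R snd p)) \<longlonglongrightarrow> f (fst p) * f (\<rho> *\<^sub>R fst p + s *\<^sub>R snd p)"
    by eventually_elim (auto intro!: tendsto_mult lim')
  then show ?thesis
    unfolding F2_def s_def[symmetric]
    by (intro integral_dominated_convergence[where w = "\<lambda>_. C * C"])
      (auto simp: abs_mult intro!: mult_mono bound AE_I2 order_trans[OF abs_ge_zero bound])
qed

lemma convex_on_LIMSEQ:
  fixes G :: "nat \<Rightarrow> 'a::real_vector \<Rightarrow> real"
  assumes cvx: "\<And>n. convex_on A (G n)" and lim: "\<And>x. x \<in> A \<Longrightarrow> (\<lambda>n. G n x) \<longlonglongrightarrow> F x"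
  shows "convex_on A F"
proof
  show A: "convex A" using cvx[of 0] by (rule convex_on_imp_convex)
  fix t x y assume t: "0 < t" "t < (1::real)" and xy: "x \<in> A" "y \<in> A"
  have "(1 - t) *\<^sub>R x + t *\<^sub>R y \<in> A" using convexD_alt[OF A xy] t by simp
  then show "F ((1 - t) *\<^sub>R x + t *\<^sub>R y) \<le> (1 - t) * F x + t * F y"
    using convex_onD[OF cvx _ _ xy] t
    by (intro LIMSEQ_le[OF lim tendsto_add[OF tendsto_mult_left tendsto_mult_left]]) (auto intro!: lim xy)
qed

lemma convex_F2_limit:
  fixes f :: "real ^ 'd::finite \<Rightarrow> real"
  assumes "\<And>n. g n \<in> borel_measurable borel" "f \<in> borel_measurable borel"
    and "\<And>n x. \<bar>g n x\<bar> \<le> C" and "AE x in lborel. (\<lambda>n. g n x) \<longlonglongrightarrow> f x"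
    and "\<And>n. convex_on {0..1} (F2 (g n))"
  shows "convex_on {0..1} (F2 f)"
  using F2_tendsto[OF assms(1-4)] by (intro convex_on_LIMSEQ[OF assms(5)])

section \<open>Trigonometric sums\<close>

definition exp_sum_of :: "(complex \<times> 'a::real_inner) list \<Rightarrow> 'a \<Rightarrow> complex" where
  "exp_sum_of L x = (\<Sum>(c, u)\<leftarrow>L. c * iexp (u \<bullet> x))"

definition trig_sum :: "('a::real_inner \<Rightarrow> real) \<Rightarrow> bool" where
  "trig_sum f \<longleftrightarrow> (\<exists>L. \<forall>x. complex_of_real (f x) = exp_sum_of L x)"

lemma exp_sum_of_add: "exp_sum_of L x + exp_sum_of M x = exp_sum_of (L @ M) x"
  by (simp add: exp_sum_of_def)

text \<open>Multiplying exponentials adds frequencies. Since a list may repeat a frequency, the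
  product is the plain list of all pairs, with no terms to collect.\<close>

lemma exp_sum_of_mult: "\<exists>K. \<forall>x. exp_sum_of L x * exp_sum_of M x = exp_sum_of K x"
proof (induction L)
  case Nil
  show ?case by (rule exI[of _ "[]"]) (simp add: exp_sum_of_def)
next
  case (Cons a L)
  obtain c u where a: "a = (c, u)" by force
  obtain K where K: "\<And>x. exp_sum_of L x * exp_sum_of M x = exp_sum_of K x" using Cons by blast
  have *: "c * iexp (u \<bullet> x) * exp_sum_of M x = exp_sum_of (map (\<lambda>(d, v). (c * d, u + v)) M) x" for x
    by (induction M) (auto simp: exp_sum_of_def algebra_simps exp_add)
  have "exp_sum_of (a # L) x * exp_sum_of M x
      = exp_sum_of (map (\<lambda>(d, v). (c * d, u + v)) M @ K) x" for x
  proof -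
    have "exp_sum_of (a # L) x = c * iexp (u \<bullet> x) + exp_sum_of L x" by (simp add: exp_sum_of_def a)
    then show ?thesis by (simp only: distrib_right * K exp_sum_of_add)
  qed
  then show ?case by blast
qed

lemma trig_sum_add: "trig_sum f \<Longrightarrow> trig_sum g \<Longrightarrow> trig_sum (\<lambda>x. f x + g x)"
  unfolding trig_sum_def by (metis exp_sum_of_add of_real_add)

lemma trig_sum_mult: "trig_sum f \<Longrightarrow> trig_sum g \<Longrightarrow> trig_sum (\<lambda>x. f x * g x)"
  unfolding trig_sum_def by (metis exp_sum_of_mult of_real_mult)

lemma trig_sum_const: "trig_sum (\<lambda>x. c)"
  unfolding trig_sum_def by (rule exI[of _ "[(of_real c, 0)]"]) (simp add: exp_sum_of_def)

lemma trig_sum_sin: "trig_sum (\<lambda>x. sin (u \<bullet> x))"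
  unfolding trig_sum_def
\<comment> \<open>Euler's formula: the sine of \<open>t\<close> is \<open>- \<i> / 2\<close> times
  \<open>iexp t\<close> plus \<open>\<i> / 2\<close> times \<open>iexp (- t)\<close>.\<close>
proof (rule exI[of _ "[(- \<i> / 2, u), (\<i> / 2, - u)]"], rule allI)
  fix x
  show "complex_of_real (sin (u \<bullet> x)) = exp_sum_of [(- \<i> / 2, u), (\<i> / 2, - u)] x"
    by (simp add: exp_sum_of_def sin_of_real[symmetric] sin_exp_eq field_simps)
qed

lemma trig_sum_sum: "(\<And>i. i \<in> I \<Longrightarrow> trig_sum (f i)) \<Longrightarrow> trig_sum (\<lambda>x. \<Sum>i\<in>I. f i x)"
  by (induction I rule: infinite_finite_induct) (auto intro: trig_sum_add trig_sum_const)

lemma exp_sum_of_nth: "exp_sum_of L x = (\<Sum>j<length L. fst (L ! j) * iexp (snd (L ! j) \<bullet> x))"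
  by (simp add: exp_sum_of_def sum_list_sum_nth split_beta atLeast0LessThan)

lemma trig_sum_continuous: assumes "trig_sum f" shows "continuous_on A f"
proof -
  obtain L where "\<And>x. complex_of_real (f x) = exp_sum_of L x" using assms by (auto simp: trig_sum_def)
  then have "f = (\<lambda>x. Re (exp_sum_of L x))" by (metis Re_complex_of_real)
  then show ?thesis by (simp only: exp_sum_of_nth) (intro continuous_intros)
qed

section \<open>Positive semidefinite kernels and convexity for trigonometric sums\<close>

lemma inner_power_kernel_nonneg:
  fixes u :: "'i \<Rightarrow> 'a::euclidean_space" and z :: "'i \<Rightarrow> complex"
  shows "0 \<le> Re (\<Sum>i\<in>I. \<Sum>j\<in>I. z i * cnj (z j) * of_real ((u i \<bullet> u j) ^ k))"
proof (induction k arbitrary: z)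
  case 0
  have "(\<Sum>i\<in>I. \<Sum>j\<in>I. z i * cnj (z j)) = (\<Sum>i\<in>I. z i) * cnj (\<Sum>i\<in>I. z i)"
    by (simp add: sum_product)
  also have "\<dots> = of_real ((cmod (\<Sum>i\<in>I. z i))\<^sup>2)" by (rule complex_norm_square[symmetric])
  finally show ?case by simp
next
  case (Suc k)
  \<comment> \<open>One factor \<open>u i \<bullet> u j\<close> is expanded over the coordinates,
    and each coordinate is absorbed into the weights \<open>z\<close>. What remains is a sum of
    forms of degree \<open>k\<close>, to which the induction hypothesis applies with new
    weights.\<close>
  have "(\<Sum>i\<in>I. \<Sum>j\<in>I. z i * cnj (z j) * of_real ((u i \<bullet> u j) ^ Suc k))
     = (\<Sum>i\<in>I. \<Sum>j\<in>I. \<Sum>b\<in>Basis. (z i * of_real (u i \<bullet> b)) * cnj (z j * of_real (u j \<bullet> b)) * of_real ((u i \<bullet> u j) ^ k))"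
  proof (intro sum.cong refl)
    fix i j
    have "complex_of_real (u i \<bullet> u j) = (\<Sum>b\<in>Basis. of_real (u i \<bullet> b) * of_real (u j \<bullet> b))"
      by (subst euclidean_inner) simp
    then show "z i * cnj (z j) * of_real ((u i \<bullet> u j) ^ Suc k)
      = (\<Sum>b\<in>Basis. (z i * of_real (u i \<bullet> b)) * cnj (z j * of_real (u j \<bullet> b)) * of_real ((u i \<bullet> u j) ^ k))"
      by (simp add: sum_distrib_left sum_distrib_right mult_ac)
  qed
  also have "\<dots> = (\<Sum>b\<in>Basis. \<Sum>i\<in>I. \<Sum>j\<in>I. (z i * of_real (u i \<bullet> b)) * cnj (z j * of_real (u j \<bullet> b)) * of_real ((u i \<bullet> u j) ^ k))"
    by (simp only: sum.swap[of _ Basis I])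
  finally show ?case using Suc[of "\<lambda>i. z i * of_real (u i \<bullet> b)" for b] by (simp add: sum_nonneg)
qed

text \<open>Expanding the exponential gives a power series in \<open>r\<close> whose coefficients
  \<open>M k / fact k\<close> are nonnegative, and each power of \<open>r\<close> is convex on the
  nonnegative half-line. The partial sums are therefore convex, and so is their limit.\<close>

lemma convex_on_exp_kernel:
  fixes u :: "'i \<Rightarrow> 'a::euclidean_space" and z :: "'i \<Rightarrow> complex"
  shows "convex_on {0..} (\<lambda>r. Re (\<Sum>i\<in>I. \<Sum>j\<in>I. z i * cnj (z j) * of_real (exp (r * (u i \<bullet> u j)))))"
proof (rule convex_on_LIMSEQ)
  define M where "M = (\<lambda>k. Re (\<Sum>i\<in>I. \<Sum>j\<in>I. z i * cnj (z j) * of_real ((u i \<bullet> u j) ^ k)))"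
  have M: "0 \<le> M k" for k unfolding M_def by (rule inner_power_kernel_nonneg)
  have pow: "convex_on {0..} (\<lambda>r::real. r ^ k)" for k
    by (cases "even k") (auto intro: convex_power_odd convex_on_subset[OF convex_power_even])
  show "convex_on {0..} (\<lambda>r. \<Sum>k<n. (M k / fact k) * r ^ k)" for n
  proof (induction n)
    case 0
    show ?case by (simp add: convex_on_const)
  next
    case (Suc n)
    show ?case unfolding sum.lessThan_Suc
      by (intro convex_on_add Suc convex_on_cmul pow) (simp add: M)
  qed
  fix r :: real
  have "(\<lambda>k. \<Sum>i\<in>I. \<Sum>j\<in>I. z i * cnj (z j) * of_real ((r * (u i \<bullet> u j)) ^ k /\<^sub>R fact k))
      sums (\<Sum>i\<in>I. \<Sum>j\<in>I. z i * cnj (z j) * of_real (exp (r * (u i \<bullet> u j))))"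
    by (intro sums_sum sums_mult sums_of_real exp_converges)
  then have "(\<lambda>k. Re (\<Sum>i\<in>I. \<Sum>j\<in>I. z i * cnj (z j) * of_real ((r * (u i \<bullet> u j)) ^ k /\<^sub>R fact k)))
      sums Re (\<Sum>i\<in>I. \<Sum>j\<in>I. z i * cnj (z j) * of_real (exp (r * (u i \<bullet> u j))))"
    by (rule sums_Re)
  moreover have "Re (\<Sum>i\<in>I. \<Sum>j\<in>I. z i * cnj (z j) * of_real ((r * (u i \<bullet> u j)) ^ k /\<^sub>R fact k))
      = (M k / fact k) * r ^ k" for k
  proof -
    have "(\<Sum>i\<in>I. \<Sum>j\<in>I. z i * cnj (z j) * of_real ((r * (u i \<bullet> u j)) ^ k /\<^sub>R fact k))
        = of_real (r ^ k / fact k) * (\<Sum>i\<in>I. \<Sum>j\<in>I. z i * cnj (z j) * of_real ((u i \<bullet> u j) ^ k))"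
      by (simp add: sum_distrib_left power_mult_distrib field_simps)
    moreover have "Re (of_real a * w) = w' * a" if "Re w = w'" for a w w' using that by simp
    ultimately show ?thesis by (simp only: M_def) simp
  qed
  ultimately show "(\<lambda>n. \<Sum>k<n. (M k / fact k) * r ^ k)
      \<longlonglongrightarrow> Re (\<Sum>i\<in>I. \<Sum>j\<in>I. z i * cnj (z j) * of_real (exp (r * (u i \<bullet> u j))))"
    by (simp add: sums_def)
qed

text \<open>Collecting the exponents splits the integrand into a function of \<open>fst p\<close>
  with frequency \<open>a\<close> and one of \<open>snd p\<close> with frequency \<open>b\<close>,
  so the integral is a product of two Gaussian characteristic functions. The terms quadratic in
  \<open>\<rho>\<close> cancel because \<open>s\<^sup>2 = 1 - \<rho>\<^sup>2\<close>.\<close>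

lemma integral_correlated_iexp:
  fixes u v :: "real ^ 'd::finite"
  assumes \<rho>: "\<rho> \<in> {0..1}"
  shows "(\<integral>p. iexp (u \<bullet> fst p) * cnj (iexp (v \<bullet> (\<rho> *\<^sub>R fst p + sqrt (1 - \<rho>\<^sup>2) *\<^sub>R snd p)))
      \<partial>(std_gauss \<Otimes>\<^sub>M std_gauss))
    = of_real (exp (- (norm u)\<^sup>2 / 2) * exp (- (norm v)\<^sup>2 / 2) * exp (\<rho> * (u \<bullet> v)))"
    and "integrable (std_gauss \<Otimes>\<^sub>M std_gauss)
      (\<lambda>p. iexp (u \<bullet> fst p) * cnj (iexp (v \<bullet> (\<rho> *\<^sub>R fst p + sqrt (1 - \<rho>\<^sup>2) *\<^sub>R snd p))))"
proof -
  define s where "s = sqrt (1 - \<rho>\<^sup>2)"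
  have s: "s\<^sup>2 = 1 - \<rho>\<^sup>2" using \<rho> by (simp add: s_def power_le_one)
  define a b where "a = u - \<rho> *\<^sub>R v" and "b = - s *\<^sub>R v"
  have split: "iexp (u \<bullet> fst p) * cnj (iexp (v \<bullet> (\<rho> *\<^sub>R fst p + s *\<^sub>R snd p)))
      = iexp (a \<bullet> fst p) * iexp (b \<bullet> snd p)" for p
    by (simp add: exp_cnj exp_add[symmetric] a_def b_def algebra_simps)
  have [measurable]: "(\<lambda>x. iexp (w \<bullet> x)) \<in> borel_measurable borel" for w :: "real ^ 'd"
    by (intro borel_measurable_continuous_onI continuous_intros)
  have int: "integrable (std_gauss \<Otimes>\<^sub>M std_gauss) (\<lambda>p. iexp (a \<bullet> fst p) * iexp (b \<bullet> snd p))"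
  proof (rule std_gauss_pair.P.integrable_const_bound[of _ 1])
    show "AE p in std_gauss \<Otimes>\<^sub>M std_gauss. norm (iexp (a \<bullet> fst p) * iexp (b \<bullet> snd p)) \<le> 1"
      by (simp add: norm_mult)
    show "(\<lambda>p. iexp (a \<bullet> fst p) * iexp (b \<bullet> snd p)) \<in> borel_measurable (std_gauss \<Otimes>\<^sub>M std_gauss)"
      by measurable
  qed
  then show "integrable (std_gauss \<Otimes>\<^sub>M std_gauss)
      (\<lambda>p. iexp (u \<bullet> fst p) * cnj (iexp (v \<bullet> (\<rho> *\<^sub>R fst p + sqrt (1 - \<rho>\<^sup>2) *\<^sub>R snd p))))"
    unfolding s_def[symmetric] split .
  have "(\<integral>p. iexp (a \<bullet> fst p) * iexp (b \<bullet> snd p) \<partial>(std_gauss \<Otimes>\<^sub>M std_gauss))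
      = (\<integral>x. \<integral>z. iexp (a \<bullet> x) * iexp (b \<bullet> z) \<partial>std_gauss \<partial>std_gauss)"
    by (subst std_gauss_pair.integral_fst'[OF int, symmetric]) simp
  also have "\<dots> = of_real (exp (- (norm a)\<^sup>2 / 2)) * of_real (exp (- (norm b)\<^sup>2 / 2))"
    by (simp only: Bochner_Integration.integral_mult_right_zero Bochner_Integration.integral_mult_left_zero char_std_gauss)
  also have "\<dots> = of_real (exp (- (norm a)\<^sup>2 / 2 + - (norm b)\<^sup>2 / 2))"
    by (simp only: exp_add of_real_mult)
  also have "- (norm a)\<^sup>2 / 2 + - (norm b)\<^sup>2 / 2 = - (norm u)\<^sup>2 / 2 + - (norm v)\<^sup>2 / 2 + \<rho> * (u \<bullet> v)"
  proof -
    have "(norm a)\<^sup>2 = (norm u)\<^sup>2 - 2 * \<rho> * (u \<bullet> v) + \<rho>\<^sup>2 * (norm v)\<^sup>2"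
      unfolding power2_norm_eq_inner a_def by (simp add: inner_diff inner_commute power2_eq_square algebra_simps)
    moreover have "(norm b)\<^sup>2 = (1 - \<rho>\<^sup>2) * (norm v)\<^sup>2"
      by (simp add: b_def power_mult_distrib s)
    ultimately show ?thesis by (simp add: field_simps)
  qed
  finally show "(\<integral>p. iexp (u \<bullet> fst p) * cnj (iexp (v \<bullet> (\<rho> *\<^sub>R fst p + sqrt (1 - \<rho>\<^sup>2) *\<^sub>R snd p)))
      \<partial>(std_gauss \<Otimes>\<^sub>M std_gauss))
    = of_real (exp (- (norm u)\<^sup>2 / 2) * exp (- (norm v)\<^sup>2 / 2) * exp (\<rho> * (u \<bullet> v)))"
    unfolding s_def[symmetric] split by (simp only: exp_add)
qed

lemma convex_F2_trig_sum:
  fixes f :: "real ^ 'd::finite \<Rightarrow> real"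
  assumes "trig_sum f"
  shows "convex_on {0..1} (F2 f)"
proof -
  obtain L where L: "\<And>x. complex_of_real (f x) = exp_sum_of L x" using assms by (auto simp: trig_sum_def)
  define c u where "c = (\<lambda>j. fst (L ! j))" and "u = (\<lambda>j. snd (L ! j))"
  define z where "z = (\<lambda>j. c j * of_real (exp (- (norm (u j))\<^sup>2 / 2)))"
  let ?I = "{..<length L}"
  have f: "complex_of_real (f x) = (\<Sum>j\<in>?I. c j * iexp (u j \<bullet> x))" for x
    by (simp add: L exp_sum_of_nth c_def u_def)
  have "F2 f \<rho> = Re (\<Sum>i\<in>?I. \<Sum>j\<in>?I. z i * cnj (z j) * of_real (exp (\<rho> * (u i \<bullet> u j))))"
    if \<rho>: "\<rho> \<in> {0..1}" for \<rho>
  proof -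
    define y where "y = (\<lambda>p :: (real ^ 'd) \<times> (real ^ 'd). \<rho> *\<^sub>R fst p + sqrt (1 - \<rho>\<^sup>2) *\<^sub>R snd p)"
    have "complex_of_real (f (fst p) * f (y p))
        = (\<Sum>i\<in>?I. \<Sum>j\<in>?I. c i * cnj (c j) * (iexp (u i \<bullet> fst p) * cnj (iexp (u j \<bullet> y p))))" for p
    proof -
      \<comment> \<open>As \<open>f\<close> is real, its second value may be conjugated; this makes
        the double sum a Hermitian form.\<close>
      have "complex_of_real (f (fst p) * f (y p)) = complex_of_real (f (fst p)) * cnj (complex_of_real (f (y p)))"
        by simp
      also have "\<dots> = (\<Sum>i\<in>?I. \<Sum>j\<in>?I. (c i * iexp (u i \<bullet> fst p)) * cnj (c j * iexp (u j \<bullet> y p)))"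
        unfolding f by (simp only: cnj_sum sum_product)
      finally show ?thesis by (simp only: complex_cnj_mult mult_ac)
    qed
    then have "complex_of_real (F2 f \<rho>)
        = (\<integral>p. (\<Sum>i\<in>?I. \<Sum>j\<in>?I. c i * cnj (c j) * (iexp (u i \<bullet> fst p) * cnj (iexp (u j \<bullet> y p))))
             \<partial>(std_gauss \<Otimes>\<^sub>M std_gauss))"
      unfolding F2_def y_def integral_complex_of_real[symmetric] by (simp only:)
    also have "\<dots> = (\<Sum>i\<in>?I. \<Sum>j\<in>?I. c i * cnj (c j) * of_real
          (exp (- (norm (u i))\<^sup>2 / 2) * exp (- (norm (u j))\<^sup>2 / 2) * exp (\<rho> * (u i \<bullet> u j))))"
      unfolding y_def
      by (simp only: Bochner_Integration.integral_sum Bochner_Integration.integrable_sum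
          integrable_mult_right integral_mult_right_zero integral_correlated_iexp[OF \<rho>])
    also have "\<dots> = (\<Sum>i\<in>?I. \<Sum>j\<in>?I. z i * cnj (z j) * of_real (exp (\<rho> * (u i \<bullet> u j))))"
      by (intro sum.cong refl) (simp add: z_def)
    finally show ?thesis by (metis Re_complex_of_real)
  qed
  \<comment> \<open>The formula holds only on \<open>{0..1}\<close>; \<open>convex_on_LIMSEQ\<close>
    with a constant sequence transfers convexity along this pointwise equality.\<close>
  then show ?thesis
    by (intro convex_on_LIMSEQ[OF convex_on_subset[OF convex_on_exp_kernel[of z u ?I]]]) auto
qed

section \<open>Bounded continuous and bounded measurable functions as limits of trigonometric
  sums\<close>

definition sin_box :: "real \<Rightarrow> 'a::euclidean_space \<Rightarrow> 'a" where
  "sin_box R x = (\<Sum>b\<in>Basis. (R * sin ((x \<bullet> b) / R)) *\<^sub>R b)"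

text \<open>The coordinates of \<open>sin_box R x\<close> are themselves trigonometric sums, and
  these are closed under sums and products. Thus \<open>sin_box\<close> is a bounded stand-in for
  the identity that turns polynomials into trigonometric sums.\<close>

lemma trig_sum_polynomial_sin_box:
  fixes q :: "'a::euclidean_space \<Rightarrow> real"
  assumes "real_polynomial_function q"
  shows "trig_sum (\<lambda>x. q (sin_box R x))"
  using assms
proof induction
  case (linear h)
  then interpret h: bounded_linear h .
  have "trig_sum (\<lambda>x. \<Sum>b\<in>Basis. (R * h b) * sin ((b /\<^sub>R R) \<bullet> x))"
    by (intro trig_sum_sum trig_sum_mult trig_sum_const trig_sum_sin)
  also have "(\<lambda>x. \<Sum>b\<in>Basis. (R * h b) * sin ((b /\<^sub>R R) \<bullet> x)) = (\<lambda>x. h (sin_box R x))"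
    by (simp add: fun_eq_iff sin_box_def h.sum h.scaleR inner_commute divide_inverse mult_ac)
  finally show ?case .
qed (auto intro: trig_sum_const trig_sum_add trig_sum_mult)

lemma norm_sin_box_le:
  fixes x :: "'a::euclidean_space"
  assumes "0 \<le> R"
  shows "norm (sin_box R x) \<le> R * DIM('a)"
proof -
  have "norm (sin_box R x) \<le> (\<Sum>b\<in>(Basis :: 'a set). R)"
    unfolding sin_box_def
    by (rule sum_norm_le) (use assms in \<open>simp add: abs_mult mult_left_le\<close>)
  then show ?thesis by (simp add: mult.commute)
qed

lemma sin_box_tendsto: "(\<lambda>n. sin_box (real (Suc n)) x) \<longlonglongrightarrow> (x :: 'a::euclidean_space)"
proof -
  have *: "(\<lambda>n. real (Suc n) * sin (t / real (Suc n))) \<longlonglongrightarrow> t" for t :: real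
    by real_asymp
  have "(\<lambda>n. sin_box (real (Suc n)) x) \<longlonglongrightarrow> (\<Sum>b\<in>Basis. (x \<bullet> b) *\<^sub>R b)"
    unfolding sin_box_def by (intro tendsto_intros *)
  then show ?thesis by (simp add: euclidean_representation)
qed

lemma convex_F2_continuous:
  fixes f :: "real ^ 'd::finite \<Rightarrow> real"
  assumes cont: "continuous_on UNIV f" and bound: "\<And>x. \<bar>f x\<bar> \<le> C"
  shows "convex_on {0..1} (F2 f)"
proof -
  \<comment> \<open>The ball is chosen to contain the range of
    \<open>sin_box (real (Suc n))\<close>, so a good approximation on this compact set controls
    \<open>g n\<close> on the whole space.\<close>
  have "\<exists>q. real_polynomial_function q \<and>
      (\<forall>y\<in>cball 0 (real (Suc n) * DIM(real ^ 'd)). \<bar>f y - q y\<bar> < 1 / real (Suc n))" for n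
    using Stone_Weierstrass_real_polynomial_function[of "cball 0 (real (Suc n) * DIM(real ^ 'd))" f "1 / real (Suc n)"]
      continuous_on_subset[OF cont] by (metis compact_cball of_nat_0_less_iff subset_UNIV zero_less_Suc zero_less_divide_1_iff)
  then obtain q where q: "\<And>n. real_polynomial_function (q n)"
    and close: "\<And>n y. norm y \<le> real (Suc n) * DIM(real ^ 'd) \<Longrightarrow> \<bar>f y - q n y\<bar> < 1 / real (Suc n)"
    by (metis mem_cball_0)
  define g where "g = (\<lambda>n x. q n (sin_box (real (Suc n)) x))"
  have g: "trig_sum (g n)" for n unfolding g_def by (rule trig_sum_polynomial_sin_box[OF q])
  have near: "\<bar>f (sin_box (real (Suc n)) x) - g n x\<bar> < 1 / real (Suc n)" for n x
    unfolding g_def by (intro close norm_sin_box_le) simp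
  show ?thesis
  proof (rule convex_F2_limit[of g f "C + 1"])
    show "g n \<in> borel_measurable borel" for n
      by (rule borel_measurable_continuous_onI[OF trig_sum_continuous[OF g]])
    show "f \<in> borel_measurable borel" by (rule borel_measurable_continuous_onI[OF cont])
    show "convex_on {0..1} (F2 (g n))" for n by (rule convex_F2_trig_sum[OF g])
    show "\<bar>g n x\<bar> \<le> C + 1" for n x
    proof -
      have "1 / real (Suc n) \<le> 1" by simp
      then show ?thesis using near[of n x] bound[of "sin_box (real (Suc n)) x"] by linarith
    qed
    have "(\<lambda>n. g n x) \<longlonglongrightarrow> f x" for x
    proof -
      have "isCont f x" using cont by (simp add: continuous_on_eq_continuous_at)
      then have "(\<lambda>n. f (sin_box (real (Suc n)) x)) \<longlonglongrightarrow> f x"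
        by (rule isCont_tendsto_compose) (rule sin_box_tendsto)
      moreover have "(\<lambda>n. f (sin_box (real (Suc n)) x) - g n x) \<longlonglongrightarrow> 0"
        by (rule Lim_null_comparison[OF _ LIMSEQ_inverse_real_of_nat])
          (use near in \<open>auto intro!: always_eventually less_imp_le simp: inverse_eq_divide\<close>)
      ultimately show ?thesis using tendsto_diff by fastforce
    qed
    then show "AE x in lborel. (\<lambda>n. g n x) \<longlonglongrightarrow> f x" by simp
  qed
qed

text \<open>A measurable function is an almost-everywhere limit of continuous ones. Clamping these
  to the interval from \<open>- C\<close> to \<open>C\<close> keeps them continuous, makes the bound
  uniform, and leaves the limit unchanged since \<open>f\<close> takes values in that
  interval.\<close>

lemma convex_F2:
  fixes f :: "real ^ 'd::finite \<Rightarrow> real"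
  assumes f: "f \<in> borel_measurable borel" and bound: "\<And>x. \<bar>f x\<bar> \<le> C"
  shows "convex_on {0..1} (F2 f)"
proof -
  have "f measurable_on UNIV"
    using f by (intro lebesgue_measurable_imp_measurable_on_real) (auto intro: measurable_completion)
  then obtain N g where N: "negligible N" and g: "\<And>n. continuous_on UNIV (g n)"
    and lim: "\<And>x. x \<notin> N \<Longrightarrow> (\<lambda>n. g n x) \<longlonglongrightarrow> f x"
    by (auto simp: measurable_on_def)
  define h where "h = (\<lambda>n x. max (- C) (min C (g n x)))"
  have h: "continuous_on UNIV (h n)" for n unfolding h_def by (intro continuous_intros g)
  have C: "0 \<le> C" using bound[of 0] by linarith
  have hb: "\<bar>h n x\<bar> \<le> C" for n x using C by (auto simp: h_def)
  show ?thesis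
  proof (rule convex_F2_limit[of h f C])
    show "h n \<in> borel_measurable borel" for n by (rule borel_measurable_continuous_onI[OF h])
    show "convex_on {0..1} (F2 (h n))" for n by (rule convex_F2_continuous[OF h hb])
    have "(\<lambda>n. h n x) \<longlonglongrightarrow> f x" if "x \<notin> N" for x
    proof -
      have "(\<lambda>n. h n x) \<longlonglongrightarrow> max (- C) (min C (f x))"
        unfolding h_def by (intro tendsto_intros lim that)
      moreover have "max (- C) (min C (f x)) = f x" using bound[of x] by auto
      ultimately show ?thesis by simp
    qed
    moreover have "AE x in lebesgue. x \<notin> N"
      using N by (simp add: negligible_iff_null_sets AE_not_in)
    ultimately have "AE x in lebesgue. (\<lambda>n. h n x) \<longlonglongrightarrow> f x" by (auto elim: eventually_mono)
    then show "AE x in lborel. (\<lambda>n. h n x) \<longlonglongrightarrow> f x" by (simp add: AE_completion_iff)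
  qed (use f hb in auto)
qed

section \<open>Optimal distributions for an odd function convex on [0, 1]\<close>

lemma convex_on_two_point:
  fixes F :: "real \<Rightarrow> real"
  assumes F: "convex_on A F" and mem: "p \<in> A" "q \<in> A"
    and u: "p \<le> u" "u \<le> q" and uv: "u + v = p + q"
  shows "F u + F v \<le> F p + F q"
proof (cases "p = q")
  case True
  then show ?thesis using u uv by simp
next
  case False
  then have pq: "p < q" using u by simp
  \<comment> \<open>\<open>u\<close> divides the segment from \<open>p\<close> to \<open>q\<close>
    with weight \<open>l\<close> on \<open>q\<close>; as the sums agree, \<open>v\<close> does so
    with the weights exchanged.\<close>
  define l where "l = (u - p) / (q - p)"
  have l: "0 \<le> l" "l \<le> 1" using u pq by (auto simp: l_def field_simps)
  have lu: "l * (q - p) = u - p" using pq by (simp add: l_def)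
  have "F u \<le> (1 - l) * F p + l * F q"
    using convex_onD[OF F l mem] lu by (simp add: algebra_simps)
  moreover have "F v \<le> l * F p + (1 - l) * F q"
  proof -
    have "v = (1 - (1 - l)) * p + (1 - l) * q" using lu uv by (simp add: algebra_simps)
    then show ?thesis using convex_onD[OF F _ _ mem, of "1 - l"] l by simp
  qed
  ultimately show ?thesis by (simp add: algebra_simps)
qed

text \<open>The chord bound multiplied by \<open>q - p\<close>: it contains no division, remains
  true for \<open>p = q\<close>, and can be added up for several points \<open>w\<close>.\<close>

lemma convex_on_chord:
  fixes F :: "real \<Rightarrow> real"
  assumes F: "convex_on A F" and mem: "p \<in> A" "q \<in> A" and w: "p \<le> w" "w \<le> q"
  shows "(q - p) * F w \<le> (q - w) * F p + (w - p) * F q"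
proof (cases "p = q")
  case False
  then have pq: "p < q" using w by simp
  define l where "l = (w - p) / (q - p)"
  have l: "0 \<le> l" "l \<le> 1" using w pq by (auto simp: l_def field_simps)
  have lw: "l * (q - p) = w - p" using pq by (simp add: l_def)
  have "F w \<le> (1 - l) * F p + l * F q"
    using convex_onD[OF F l mem] lw by (simp add: algebra_simps)
  then have "(q - p) * F w \<le> (q - p) * ((1 - l) * F p + l * F q)"
    using pq by (simp add: mult_left_mono)
  also have "\<dots> = ((q - p) - l * (q - p)) * F p + (l * (q - p)) * F q" by (simp add: algebra_simps)
  finally show ?thesis by (simp add: lw)
qed (use w in auto)

text \<open>With \<open>r = (1 - t) / 2\<close> the triple \<open>(-r, -r, 1)\<close> has bias sum
  \<open>t\<close>. Oddness moves negative biases to the other side, leaving inequalities for a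
  convex function on \<open>{0..1}\<close> with \<open>F 0 = 0\<close>; the cases count the negative
  biases.\<close>

lemma bias_sum_le_sorted:
  fixes F :: "real \<Rightarrow> real"
  assumes F: "convex_on {0..1} F" and odd: "\<And>r. F (- r) = - F r"
    and P: "(x, y, z) \<in> biasP" and sorted: "x \<le> y" "y \<le> z"
  defines "t \<equiv> x + y + z"
  shows "t \<in> {-1..0} \<and> F x + F y + F z \<le> 3 * F (t / 3) \<or> F x + F y + F z \<le> F 1 + 2 * F ((t - 1) / 2)"
proof -
  have F0: "F 0 = 0" using odd[of 0] by simp
  have P': "-1 \<le> t" "y + z - 1 \<le> x" "x + z - 1 \<le> y" "x + y - 1 \<le> z"
    using P by (auto simp: biasP_def t_def)
  define r where "r = (1 - t) / 2"
  have Fr: "F ((t - 1) / 2) = - F r"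
    using odd[of r] by (simp add: r_def minus_divide_left)
  have z1: "z \<le> 1" using P' sorted by linarith
  have r1: "r \<le> 1" using P' by (simp add: r_def)
  have two: "F u + F v \<le> F p + F q" if "0 \<le> p" "p \<le> u" "u \<le> q" "q \<le> 1" "u + v = p + q" for p q u v
    using convex_on_two_point[OF F, of p q u v] that by auto
  have super: "F u + F v \<le> F (u + v)" if "0 \<le> u" "0 \<le> v" "u + v \<le> 1" for u v
    using two[of 0 u "u + v" v] that F0 by simp
  consider (pos) "0 \<le> x" | (neg1) "x < 0" "0 \<le> y" | (neg2) "y < 0" "0 \<le> z" | (neg) "z < 0"
    by linarith
  then show ?thesis
  proof cases
    case pos
    show ?thesis
    proof (cases "t < 1")
      case True
      \<comment> \<open>Superadditivity merges \<open>x\<close>, \<open>y\<close>, \<open>z\<close>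
        into \<open>t\<close>, and then \<open>t\<close>, \<open>r\<close>, \<open>r\<close> into
        1.\<close>
      have "F x + F y \<le> F (x + y)" "F (x + y) + F z \<le> F t" "F t + F r \<le> F (t + r)" "F (t + r) + F r \<le> F (t + r + r)"
        using super[of x y] super[of "x + y" z] super[of t r] super[of "t + r" r] pos sorted True
        by (auto simp: t_def r_def field_simps)
      moreover have "t + r + r = 1" by (simp add: r_def)
      ultimately show ?thesis using Fr by simp
    next
      case False
      \<comment> \<open>The target triple is \<open>(s, s, 1)\<close>. The polytope inequality
        \<open>y + z - 1 \<le> x\<close> gives \<open>s \<le> x\<close>, so all three biases lie
        between \<open>s\<close> and 1 and their chord bounds add up. The chord degenerates for
        \<open>s = 1\<close>.\<close>
      define s where "s = (t - 1) / 2"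
      have s: "0 \<le> s" "s \<le> x" using False P' by (auto simp: s_def t_def)
      have st: "x + y + z = 1 + 2 * s" by (simp add: s_def t_def field_simps)
      show ?thesis
      proof (cases "s = 1")
        case True
        then have "x = 1" "y = 1" "z = 1" using s sorted z1 by auto
        then show ?thesis using True by (simp add: s_def[symmetric])
      next
        case False
        then have s1: "s < 1" using s z1 sorted by linarith
        have c: "(1 - s) * F w \<le> (1 - w) * F s + (w - s) * F 1" if "s \<le> w" "w \<le> 1" for w
          using convex_on_chord[OF F, of s 1 w] s s1 that by auto
        have "(1 - s) * (F x + F y + F z) \<le> (3 - (x + y + z)) * F s + ((x + y + z) - 3 * s) * F 1"
          using c[of x] c[of y] c[of z] s sorted z1 by (simp add: algebra_simps)
        also have "\<dots> = (1 - s) * (F 1 + 2 * F s)" unfolding st by (simp add: algebra_simps)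
        finally show ?thesis using s1 by (simp add: s_def[symmetric])
      qed
    qed
  next
    case neg1
    define a where "a = - x"
    define s where "s = y + z"
    have a: "0 < a" and Fx: "F x = - F a" using neg1 odd[of a] by (auto simp: a_def)
    have s: "0 \<le> s" "s + a \<le> 1" "t = s - a" using neg1 sorted P' by (auto simp: s_def a_def t_def)
    have r2: "2 * r = 1 + a - s" by (simp add: r_def s)
    have yz: "F y + F z \<le> F s" using super[of y z] neg1 sorted s a by (simp add: s_def)
    \<comment> \<open>Both sides have the same sum of arguments, \<open>s + 2 * r = 1 + a\<close>.
      If \<open>s \<le> a\<close>, the number \<open>a - s\<close> serves as an intermediate point;
      otherwise \<open>r\<close>, \<open>r\<close> merge into \<open>2 * r\<close>, and the pair
      \<open>s\<close>, \<open>2 * r\<close> is spread to \<open>a\<close>, 1.\<close>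
    have "F s + 2 * F r \<le> F 1 + F a"
    proof (cases "s \<le> a")
      case True
      have "F s + F (a - s) \<le> F a" using super[of s "a - s"] True s by simp
      moreover have "F r + F r \<le> F (a - s) + F 1" using two[of "a - s" r 1 r] True s r2 a by simp
      ultimately show ?thesis by simp
    next
      case False
      have "F r + F r \<le> F (2 * r)" using super[of r r] r2 False s a by simp
      moreover have "F s + F (2 * r) \<le> F a + F 1" using two[of a s 1 "2 * r"] False s r2 a by simp
      ultimately show ?thesis by simp
    qed
    then show ?thesis using yz Fx Fr by simp
  next
    case neg2
    \<comment> \<open>Midpoint convexity lets both negative biases be replaced by their mean
      \<open>- m\<close>.\<close>
    define m where "m = - (x + y) / 2"
    have m: "0 < m" "m \<le> 1" using neg2 sorted P' z1 by (auto simp: m_def t_def)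
    have tm: "t = z - 2 * m" by (simp add: t_def m_def field_simps)
    have r2: "2 * r = 1 - z + 2 * m" by (simp add: r_def tm)
    have "x \<ge> -1" using P' z1 by (simp add: t_def)
    then have xy: "F x + F y \<le> - 2 * F m"
      using two[of "-y" m "-x" m] neg2 sorted odd[of x] odd[of y] by (simp add: m_def add_divide_distrib)
    show ?thesis
    proof (cases "m \<le> z")
      case True
      \<comment> \<open>The numbers \<open>z\<close>, \<open>r\<close>, \<open>r\<close> lie between
        \<open>m\<close> and 1 and sum to \<open>1 + 2 * m\<close>, so the chord over this interval
        suffices.\<close>
      have "F z + 2 * F r \<le> F 1 + 2 * F m"
      proof (cases "m = 1")
        case True
        then have "z = 1" "r = 1" using \<open>m \<le> z\<close> z1 r2 by auto
        then show ?thesis using True by simp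
      next
        case False
        have mr: "m \<le> r" using r2 z1 by simp
        have c: "(1 - m) * F w \<le> (1 - w) * F m + (w - m) * F 1" if "m \<le> w" "w \<le> 1" for w
          using convex_on_chord[OF F, of m 1 w] m that by auto
        have "(1 - m) * (F z + 2 * F r) \<le> (3 - (z + 2 * r)) * F m + ((z + 2 * r) - 3 * m) * F 1"
          using c[OF True z1] c[OF mr r1] by (simp add: algebra_simps)
        also have "z + 2 * r = 1 + 2 * m" using r2 by simp
        also have "(3 - (1 + 2 * m)) * F m + ((1 + 2 * m) - 3 * m) * F 1 = (1 - m) * (F 1 + 2 * F m)"
          by (simp add: algebra_simps)
        finally show ?thesis using m False by simp
      qed
      then show ?thesis using xy Fr by simp
    next
      case False
      \<comment> \<open>Here the diagonal triple \<open>(-k, -k, -k)\<close> is the target: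
        \<open>z\<close> and \<open>k\<close> lie between 0 and \<open>m\<close>, and the chord
        through the origin applies with \<open>z + 3 * k = 2 * m\<close>.\<close>
      define k where "k = - t / 3"
      have Fk: "F (t / 3) = - F k" using odd[of k] by (simp add: k_def)
      have k: "0 \<le> k" "k \<le> m" and zk: "z + 3 * k = 2 * m" using False neg2 by (auto simp: k_def tm diff_divide_distrib)
      have c: "m * F w \<le> w * F m" if "0 \<le> w" "w \<le> m" for w
        using convex_on_chord[OF F, of 0 m w] m that F0 by simp
      have "m * (F z + 3 * F k) \<le> (z + 3 * k) * F m"
        using c[of z] c[of k] neg2 False k by (simp add: algebra_simps)
      also have "\<dots> = m * (2 * F m)" using zk by simp
      finally have "F z + 3 * F k \<le> 2 * F m" using m by simp
      then show ?thesis using xy Fk k P' by (auto simp: k_def)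
    qed
  next
    case neg
    define k where "k = - t / 3"
    have Fk: "F (t / 3) = - F k" using odd[of k] by (simp add: k_def)
    have m: "-1 \<le> x" using P' neg sorted by (simp add: t_def)
    \<comment> \<open>Jensen's inequality with equal weights for the three numbers
      \<open>- x\<close>, \<open>- y\<close>, \<open>- z\<close>.\<close>
    have "F (\<Sum>i\<in>{0,1,2::nat}. (1/3) *\<^sub>R (if i = 0 then -x else if i = 1 then -y else -z))
       \<le> (\<Sum>i\<in>{0,1,2::nat}. (1/3) * F (if i = 0 then -x else if i = 1 then -y else -z))"
      by (rule convex_on_sum[OF _ _ F]) (use m neg sorted in auto)
    moreover have "(\<Sum>i\<in>{0,1,2::nat}. (1/3) *\<^sub>R (if i = 0 then -x else if i = 1 then -y else -z)) = k"
      by (simp add: k_def t_def)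
    ultimately have "3 * F k \<le> - F x - F y - F z" by (simp add: odd)
    then show ?thesis using Fk P' neg sorted by (auto simp: t_def)
  qed
qed

lemma bias_sum_le:
  fixes F :: "real \<Rightarrow> real"
  assumes F: "convex_on {0..1} F" and odd: "\<And>r. F (- r) = - F r"
    and P: "(x, y, z) \<in> biasP"
  shows "x + y + z \<in> {-1..0} \<and> F x + F y + F z \<le> 3 * F ((x + y + z) / 3) \<or>
    F x + F y + F z \<le> F 1 + 2 * F ((x + y + z - 1) / 2)"
proof -
  have *: "(x, z, y) \<in> biasP" "(y, x, z) \<in> biasP" "(y, z, x) \<in> biasP" "(z, x, y) \<in> biasP" "(z, y, x) \<in> biasP"
    using P by (auto simp: biasP_def)
  consider "x \<le> y" "y \<le> z" | "x \<le> z" "z \<le> y" | "y \<le> x" "x \<le> z" | "y \<le> z" "z \<le> x" | "z \<le> x" "x \<le> y" | "z \<le> y" "y \<le> x"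
    by linarith
  then show ?thesis
  proof cases
    case 1 then show ?thesis using bias_sum_le_sorted[OF F odd P] by (simp add: add_ac)
  next
    case 2 then show ?thesis using bias_sum_le_sorted[OF F odd *(1)] by (simp add: add_ac)
  next
    case 3 then show ?thesis using bias_sum_le_sorted[OF F odd *(2)] by (simp add: add_ac)
  next
    case 4 then show ?thesis using bias_sum_le_sorted[OF F odd *(3)] by (simp add: add_ac)
  next
    case 5 then show ?thesis using bias_sum_le_sorted[OF F odd *(4)] by (simp add: add_ac)
  next
    case 6 then show ?thesis using bias_sum_le_sorted[OF F odd *(5)] by (simp add: add_ac)
  qed
qed

section \<open>Mixtures of extremal triples and their reduction to two points\<close>

lemma exists_two_point_pmf:
  assumes "p \<in> {0..1::real}"
  obtains D :: "'a pmf" where "set_pmf D \<subseteq> {X, Y}"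
    "\<And>h :: 'a \<Rightarrow> real. measure_pmf.expectation D h = p * h X + (1 - p) * h Y"
proof
  let ?D = "map_pmf (\<lambda>b. if b then X else Y) (bernoulli_pmf p)"
  show "set_pmf ?D \<subseteq> {X, Y}" by auto
  show "measure_pmf.expectation ?D h = p * h X + (1 - p) * h Y" for h :: "'a \<Rightarrow> real"
    using assms by (simp add: algebra_simps)
qed

text \<open>The three target forms seen only through expected bias sum \<open>B\<close> and expected
  value \<open>V\<close>; \<open>p\<close> is the weight of the first support point.
  \<open>V\<close> is bounded from above because a larger value of the biases means a smaller
  performance.\<close>

definition hard_form :: "(real \<Rightarrow> real) \<Rightarrow> real \<Rightarrow> real \<Rightarrow> bool" where
  "hard_form F B V \<longleftrightarrow> (\<exists>p\<in>{0..1}.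
     (\<exists>r\<in>{0..1/3}. B = p * (- 3 * r) + (1 - p) * (1 - 2 * r) \<and>
        V \<le> p * (- 3 * F r) + (1 - p) * (F 1 - 2 * F r)) \<or>
     (\<exists>r\<in>{1/3..1}. B = p * (- 1) + (1 - p) * (1 - 2 * r) \<and>
        V \<le> p * (- 3 * F (1/3)) + (1 - p) * (F 1 - 2 * F r)) \<or>
     (\<exists>r\<in>{-1..1}. B = p * (1 - 2 * r) + (1 - p) * 3 \<and>
        V \<le> p * (F 1 - 2 * F r) + (1 - p) * (3 * F 1)))"

text \<open>The pair (bias sum, value) of \<open>(-r, -r, 1)\<close> is 2/3 of the pair of \<open>(-r, -r, -r)\<close> plus 1/3 of
  that of \<open>(1, 1, 1)\<close>, so one of the two outer points can be traded for the middle one.\<close>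

lemma hard_form_collinear:
  assumes p: "0 \<le> p1" "0 \<le> p2" "0 \<le> p3" "p1 + p2 + p3 = 1" and r: "0 \<le> r" "r \<le> 1/3"
    and B: "B = (p2 + 3 * p3) - (3 * p1 + 2 * p2) * r"
    and V: "V \<le> (p2 + 3 * p3) * F 1 - (3 * p1 + 2 * p2) * F r"
  shows "hard_form F B V"
proof (cases "2 * p3 \<le> p1")
  case True
  \<comment> \<open>All of \<open>p3\<close> is traded together with \<open>2 * p3\<close> of the
    weight at \<open>(-r, -r, -r)\<close>.\<close>
  define p where "p = p1 - 2 * p3"
  have "p \<in> {0..1}" using True p by (simp add: p_def)
  moreover have e: "p2 + 3 * p3 = 1 - p" "3 * p1 + 2 * p2 = 3 * p + 2 * (1 - p)"
    using p by (simp_all add: p_def)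
  have "B = p * (- 3 * r) + (1 - p) * (1 - 2 * r) \<and> V \<le> p * (- 3 * F r) + (1 - p) * (F 1 - 2 * F r)"
    using V unfolding B e by (simp add: algebra_simps)
  ultimately show ?thesis using r unfolding hard_form_def by (intro bexI[of _ p] disjI1 bexI[of _ r]) auto
next
  case False
  \<comment> \<open>All of \<open>p1\<close> is traded together with \<open>p1 / 2\<close> of the
    weight at \<open>(1, 1, 1)\<close>, which adds \<open>3 * p1 / 2\<close> to the middle
    point.\<close>
  define p where "p = p2 + 3 * p1 / 2"
  have "p \<in> {0..1}" using False p by (simp add: p_def)
  moreover have e: "p2 + 3 * p3 = p + 3 * (1 - p)" "3 * p1 + 2 * p2 = 2 * p"
    using p by (simp_all add: p_def)
  have "B = p * (1 - 2 * r) + (1 - p) * 3 \<and> V \<le> p * (F 1 - 2 * F r) + (1 - p) * (3 * F 1)"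
    using V unfolding B e by (simp add: algebra_simps)
  moreover have "r \<in> {-1..1}" using r by simp
  ultimately show ?thesis unfolding hard_form_def by blast
qed

text \<open>The middle bias sum \<open>1 - 2 * r\<close> is the combination of -1 and 3 with weights
  \<open>l\<close> and \<open>1 - l\<close>. If the middle value lies on or above the chord of the
  outer values, the outer points are traded for the middle one until one of them runs out; otherwise
  the middle point is split into the outer two.\<close>

lemma hard_form_three_points:
  assumes p: "0 \<le> p1" "0 \<le> p2" "0 \<le> p3" "p1 + p2 + p3 = 1" and r: "1/3 \<le> r" "r \<le> 1"
    and B: "B = p1 * (- 1) + p2 * (1 - 2 * r) + p3 * 3"
    and V: "V \<le> p1 * (- 3 * F (1/3)) + p2 * (F 1 - 2 * F r) + p3 * (3 * F 1)"
  shows "hard_form F B V"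
proof -
  define l where "l = (1 + r) / 2"
  have l: "0 < l" "l \<le> 1" using r by (auto simp: l_def)
  have r_l: "r = 2 * l - 1" by (simp add: l_def add_divide_distrib)
  define a m k where "a = - 3 * F (1/3)" and "m = F 1 - 2 * F r" and "k = 3 * F 1"
  have V': "V \<le> p1 * a + p2 * m + p3 * k" using V by (simp add: a_def m_def k_def)
  show ?thesis
  proof (cases "l * a + (1 - l) * k \<le> m")
    case True
    have gain: "V \<le> (p1 - l * q) * a + (p2 + q) * m + (p3 - (1 - l) * q) * k" if "0 \<le> q" for q
    proof -
      have "q * (l * a + (1 - l) * k) \<le> q * m" using True that by (rule mult_left_mono)
      then show ?thesis using V' by (simp add: algebra_simps)
    qed
    show ?thesis
    proof (cases "p1 * (1 - l) \<le> p3 * l")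
      case True
      \<comment> \<open>The amount of trade that exhausts the weight \<open>p1\<close>.\<close>
      define q where "q = p1 / l"
      have q: "0 \<le> q" "l * q = p1" using p l by (auto simp: q_def)
      have "l * ((1 - l) * q) \<le> l * p3"
        using True q(2) by (metis mult.assoc mult.commute)
      then have q3: "(1 - l) * q \<le> p3" using l by simp
      define s where "s = p2 + q"
      have s1: "1 - s = p3 - (1 - l) * q" using p q(2) by (simp add: s_def algebra_simps)
      have "s \<in> {0..1}" using p q q3 s1 by (simp add: s_def)
      moreover have "B = s * (1 - 2 * r) + (1 - s) * 3"
        unfolding s1 by (simp add: s_def B r_l q(2)[symmetric] algebra_simps)
      moreover have "V \<le> s * m + (1 - s) * k"
        using gain[OF q(1)] q(2) unfolding s1 by (simp add: s_def)
      moreover have "r \<in> {-1..1}" using r by simp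
      ultimately show ?thesis unfolding hard_form_def m_def k_def by blast
    next
      case False
      then have l1: "l < 1" using l p by (cases "l = 1") auto
      \<comment> \<open>The amount of trade that exhausts the weight \<open>p3\<close>.\<close>
      define q where "q = p3 / (1 - l)"
      have q: "0 \<le> q" "(1 - l) * q = p3" using p l1 by (auto simp: q_def)
      have "(1 - l) * (l * q) \<le> (1 - l) * p1"
        using False q(2) by (metis linorder_le_cases mult.assoc mult.commute)
      then have q3: "l * q \<le> p1" using l1 by simp
      define s where "s = p1 - l * q"
      have s1: "1 - s = p2 + q" using p q(2) by (simp add: s_def algebra_simps)
      have "s \<in> {0..1}" using p q q3 s1 by (simp add: s_def)
      moreover have "B = s * (- 1) + (1 - s) * (1 - 2 * r)"
        unfolding s1 by (simp add: s_def B r_l q(2)[symmetric] algebra_simps)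
      moreover have "V \<le> s * a + (1 - s) * m"
        using gain[OF q(1)] q(2) unfolding s1 by (simp add: s_def)
      moreover have "r \<in> {1/3..1}" using r by simp
      ultimately show ?thesis unfolding hard_form_def m_def a_def by blast
    qed
  next
    case False
    then have "p2 * m \<le> p2 * (l * a + (1 - l) * k)" using p by (simp add: mult_left_mono)
    then have "V \<le> (p1 + l * p2) * a + (p3 + (1 - l) * p2) * k"
      using V' by (simp add: algebra_simps)
    moreover have "B = (p1 + l * p2) * (- 1) + (p3 + (1 - l) * p2) * 3"
      by (simp add: B r_l algebra_simps)
    moreover have "0 \<le> p1 + l * p2" "0 \<le> p3 + (1 - l) * p2" "p1 + l * p2 + 0 + (p3 + (1 - l) * p2) = 1"
      using p l mult_nonneg_nonneg[of l p2] mult_nonneg_nonneg[of "1 - l" p2]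
      by (auto simp: left_diff_distrib)
    ultimately show ?thesis
      by (intro hard_form_collinear[of "p1 + l * p2" 0 "p3 + (1 - l) * p2" "1/3"]) (auto simp: a_def k_def algebra_simps)
  qed
qed

text \<open>The biases \<open>- r1\<close> and \<open>- r2\<close> occur with total weights
  \<open>3 * p1\<close> and \<open>2 * p2\<close>. If their weighted mean \<open>r\<close> is at
  most 1/3, Jensen's inequality replaces both by \<open>r\<close>. Otherwise \<open>r1\<close> moves
  up to 1/3 and \<open>r2\<close> down to \<open>s\<close> with the weighted sum fixed, which cannot
  increase the weighted sum of \<open>F\<close>.\<close>

lemma hard_form_mixture:
  fixes F :: "real \<Rightarrow> real"
  assumes F: "convex_on {0..1} F"
    and p: "0 \<le> p1" "0 \<le> p2" "0 \<le> p3" "p1 + p2 + p3 = 1"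
    and r1: "0 \<le> r1" "r1 \<le> 1/3" and r2: "0 \<le> r2" "r2 \<le> 1"
    and B: "B = p1 * (- 3 * r1) + p2 * (1 - 2 * r2) + p3 * 3"
    and V: "V \<le> p1 * (- 3 * F r1) + p2 * (F 1 - 2 * F r2) + p3 * (3 * F 1)"
  shows "hard_form F B V"
proof -
  define c where "c = 3 * p1 + 2 * p2"
  show ?thesis
  proof (cases "c = 0")
    case True
    then have "p1 = 0" "p2 = 0" using p by (auto simp: c_def)
    then show ?thesis
      using B V p by (intro hard_form_collinear[of p1 p2 p3 0]) auto
  next
    case False
    then have c: "0 < c" using p by (simp add: c_def)
    define r where "r = (3 * p1 * r1 + 2 * p2 * r2) / c"
    have cr: "c * r = 3 * p1 * r1 + 2 * p2 * r2" using c by (simp add: r_def)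
    show ?thesis
    proof (cases "r \<le> 1/3")
      case True
      have r0: "0 \<le> r" using p r1 r2 c by (simp add: r_def)
      define u where "u = 2 * p2 / c"
      have u: "0 \<le> u" "u \<le> 1" using p c by (auto simp: u_def c_def)
      have cu: "c * u = 2 * p2" "c * (1 - u) = 3 * p1" using c by (auto simp: u_def c_def field_simps)
      have "c * r = c * ((1 - u) * r1 + u * r2)"
        unfolding cr distrib_left mult.assoc[symmetric] cu by simp
      then have "r = (1 - u) * r1 + u * r2" using c by simp
      then have "F r \<le> (1 - u) * F r1 + u * F r2"
        using convex_onD[OF F u, of r1 r2] r1 r2 by simp
      then have "c * F r \<le> c * ((1 - u) * F r1 + u * F r2)" using c by simp
      then have "c * F r \<le> 3 * p1 * F r1 + 2 * p2 * F r2"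
        unfolding distrib_left mult.assoc[symmetric] cu .
      then show ?thesis
        using B V cr p r0 True
        by (intro hard_form_collinear[of p1 p2 p3 r]) (auto simp: c_def algebra_simps)
    next
      case False
      have p2: "0 < p2"
      proof (rule ccontr)
        assume "\<not> 0 < p2"
        then have "p2 = 0" using p by simp
        then have "r = r1" using c by (simp add: r_def c_def)
        then show False using False r1 by simp
      qed
      \<comment> \<open>Chosen so that \<open>3 * p1 * (1/3) + 2 * p2 * s\<close> equals
        \<open>c * r\<close>. Both 1/3 and \<open>s\<close> lie between \<open>r1\<close> and
        \<open>r2\<close>, so the chord over that interval bounds \<open>F\<close> at both.\<close>
      define s where "s = r2 - 3 * p1 * (1/3 - r1) / (2 * p2)"
      have s: "2 * p2 * s = 2 * p2 * r2 - 3 * p1 * (1/3 - r1)" using p2 by (simp add: s_def field_simps)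
      have s2: "s \<le> r2" using p p2 r1 by (simp add: s_def)
      have "1/3 * c < c * r" using False c by simp
      then have "2 * p2 * (1/3) < 2 * p2 * s" unfolding s cr by (simp add: c_def algebra_simps)
      then have s3: "1/3 < s" using p2 by simp
      have ch: "(r2 - r1) * F w \<le> (r2 - w) * F r1 + (w - r1) * F r2" if "r1 \<le> w" "w \<le> r2" for w
        using convex_on_chord[OF F, of r1 r2 w] r1 r2 that by auto
      have "(r2 - r1) * (3 * p1 * F (1/3) + 2 * p2 * F s)
          \<le> 3 * p1 * ((r2 - 1/3) * F r1 + (1/3 - r1) * F r2) + 2 * p2 * ((r2 - s) * F r1 + (s - r1) * F r2)"
        using mult_left_mono[OF ch[of "1/3"], of "3 * p1"] mult_left_mono[OF ch[of s], of "2 * p2"] p r1 s2 s3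
        by (simp add: algebra_simps)
      also have "\<dots> = (c * r2 - p1 - 2 * p2 * s) * F r1 + (p1 + 2 * p2 * s - c * r1) * F r2"
        by (simp add: c_def algebra_simps)
      also have "\<dots> = (r2 - r1) * (3 * p1 * F r1 + 2 * p2 * F r2)"
        unfolding s by (simp add: c_def algebra_simps)
      finally have "3 * p1 * F (1/3) + 2 * p2 * F s \<le> 3 * p1 * F r1 + 2 * p2 * F r2"
        using s2 s3 r1 by simp
      then have "V \<le> p1 * (- 3 * F (1/3)) + p2 * (F 1 - 2 * F s) + p3 * (3 * F 1)"
        using V by (simp add: algebra_simps)
      moreover have "B = p1 * (- 1) + p2 * (1 - 2 * s) + p3 * 3"
        using s by (simp add: B algebra_simps)
      ultimately show ?thesis
        using p s2 s3 r2 by (intro hard_form_three_points[of p1 p2 p3 s]) auto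
    qed
  qed
qed

text \<open>In the plane of pairs (bias sum, value), every triple of the polytope lands in the
  convex hull of three convex sets, hence so does the expectation. A point of such a hull uses only
  one point from each set, which performs Jensen's inequality within each family.\<close>

lemma hard_form_expectation:
  fixes F :: "real \<Rightarrow> real" and D :: "triple pmf"
  assumes F: "convex_on {0..1} F" and odd: "\<And>r. F (- r) = - F r" and D: "fin_dist_on_P D"
  shows "hard_form F (measure_pmf.expectation D (\<lambda>(a, b, c). a + b + c))
    (measure_pmf.expectation D (\<lambda>(a, b, c). F a + F b + F c))"
proof -
  have F0: "F 0 = 0" using odd[of 0] by simp
  define E where "E = (\<lambda>m. epigraph {0..m} F)"
  have E: "convex (E m)" if "m \<le> 1" for m
    unfolding E_def by (rule convex_epigraphI[OF convex_on_subset[OF F]]) (use that in auto)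
  \<comment> \<open>The sets of pairs at or below those of \<open>(-r, -r, -r)\<close>,
    \<open>(-r, -r, 1)\<close> and \<open>(1, 1, 1)\<close>. The first two are convex as affine
    images of epigraphs of \<open>F\<close>, the negative factors turning them upside down.\<close>
  define C where "C = (\<lambda>i::nat. if i = 0 then (*\<^sub>R) (- 3) ` E (1/3)
       else if i = 1 then (\<lambda>x. (1, F 1) + (- 2) *\<^sub>R x) ` E 1 else {3} \<times> {..3 * F 1})"
  define H where "H = convex hull (\<Union>(C ` {0,1,2}))"
  have CH: "x \<in> H" if "x \<in> C i" "i \<in> {0,1,2}" for i x
    unfolding H_def by (rule hull_inc) (use that in blast)
  have C_convex: "convex (C i)" for i
    unfolding C_def
    using convex_scaling[OF E, of "1/3" "- 3"] convex_affinity[OF E, of 1 "(1, F 1)" "- 2"]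
    by (simp add: convex_Times)
  have C0: "(t, v) \<in> C 0" if "t = - 3 * r" "0 \<le> r" "r \<le> 1/3" "v \<le> - 3 * F r" for t v r
    unfolding C_def E_def using that
    by (auto simp: epigraph_def intro!: image_eqI[of _ _ "(r, - v / 3)"])
  have C1: "(t, v) \<in> C 1" if "t = 1 - 2 * r" "0 \<le> r" "r \<le> 1" "v \<le> F 1 - 2 * F r" for t v r
    unfolding C_def E_def using that
    by (auto simp: epigraph_def field_simps intro!: image_eqI[of _ _ "(r, (F 1 - v) / 2)"])
  have pt: "(x + y + z, F x + F y + F z) \<in> H" if P: "(x, y, z) \<in> biasP" for x y z
  proof -
    define t where "t = x + y + z"
    define v where "v = F x + F y + F z"
    have t: "-1 \<le> t" "t \<le> 3" using P by (auto simp: biasP_def t_def)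
    consider "t \<in> {-1..0}" "v \<le> 3 * F (t / 3)" | "v \<le> F 1 + 2 * F ((t - 1) / 2)"
      using bias_sum_le[OF F odd P] by (auto simp: t_def v_def)
    then have "(t, v) \<in> H"
    proof cases
      case 1
      then show ?thesis using odd[of "- t / 3"] by (intro CH[of _ 0] C0[of _ "- t / 3"]) auto
    next
      case 2
      \<comment> \<open>This \<open>r\<close> has the sign opposite to the parameter of
        \<open>C1\<close>: the dominating triple is \<open>(r, r, 1)\<close>.\<close>
      define r where "r = (t - 1) / 2"
      have tr: "t = 1 + 2 * r" by (simp add: r_def field_simps)
      show ?thesis
      proof (cases "r \<le> 0")
        case True
        then show ?thesis
          using 2 odd[of r] t by (intro CH[of _ 1] C1[of _ "- r"]) (auto simp: tr r_def[symmetric])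
      next
        case False
        have "F r \<le> r * F 1"
          using convex_on_chord[OF F, of 0 1 r] False t tr F0 by simp
        then have v: "v \<le> F 1 + 2 * r * F 1" using 2 by (simp add: r_def[symmetric])
        \<comment> \<open>For \<open>r > 0\<close> the pair lies at or below the segment from the
          pair of \<open>(0, 0, 1)\<close> to that of \<open>(1, 1, 1)\<close>. Lowering both ends
          by the slack \<open>e\<close> makes the combination hit \<open>(t, v)\<close>
          exactly.\<close>
        define e where "e = F 1 + 2 * r * F 1 - v"
        have "0 \<le> e" using v by (simp add: e_def)
        then have "(1, F 1 - e) \<in> C 1" "(3, 3 * F 1 - e) \<in> C 2"
          using F0 by (intro C1[of _ 0], auto) (simp add: C_def)
        then have "(1, F 1 - e) \<in> H" "(3, 3 * F 1 - e) \<in> H"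
          by (auto intro: CH)
        from convexD_alt[OF _ this, of r] have "(1 - r) *\<^sub>R (1, F 1 - e) + r *\<^sub>R (3, 3 * F 1 - e) \<in> H"
          using False t tr by (simp add: H_def)
        also have "(1 - r) *\<^sub>R (1, F 1 - e) + r *\<^sub>R (3, 3 * F 1 - e) = (t, v)"
          by (simp add: tr e_def algebra_simps)
        finally show ?thesis .
      qed
    qed
    then show ?thesis by (simp add: t_def v_def)
  qed
  define B where "B = measure_pmf.expectation D (\<lambda>(a, b, c). a + b + c)"
  define V where "V = measure_pmf.expectation D (\<lambda>(a, b, c). F a + F b + F c)"
  have fin: "finite (set_pmf D)" and sub: "set_pmf D \<subseteq> biasP" using D by (auto simp: fin_dist_on_P_def)
  have "(\<Sum>b\<in>set_pmf D. pmf D b *\<^sub>R (case b of (x, y, z) \<Rightarrow> (x + y + z, F x + F y + F z))) \<in> H"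
  proof (rule convex_sum[OF fin])
    show "convex H" by (simp add: H_def)
    show "sum (pmf D) (set_pmf D) = 1" by (rule sum_pmf_eq_1[OF fin]) simp
  qed (use sub pt in auto)
  also have "(\<Sum>b\<in>set_pmf D. pmf D b *\<^sub>R (case b of (x, y, z) \<Rightarrow> (x + y + z, F x + F y + F z))) = (B, V)"
    unfolding B_def V_def
    by (subst (1 2) integral_measure_pmf[OF fin])
      (auto simp: prod_eq_iff fst_sum snd_sum split_beta intro!: sum.cong)
  finally have "(B, V) \<in> H" .
  moreover have "H = {\<Sum>i\<in>{0,1,2}. c i *\<^sub>R s i | c s.
      (\<forall>i\<in>{0,1,2}. 0 \<le> c i) \<and> sum c {0,1,2} = 1 \<and> (\<forall>i\<in>{0,1,2}. s i \<in> C i)}"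
    unfolding H_def using C_convex C0[of _ 0 "- 3 * F 0"] C1[of _ 0 "F 1 - 2 * F 0"]
    by (intro convex_hull_finite_union) (auto simp: C_def)
  ultimately obtain c s where c: "\<forall>i\<in>{0,1,2::nat}. 0 \<le> c i" "sum c {0,1,2} = 1"
    and s: "\<forall>i\<in>{0,1,2}. s i \<in> C i" and BV: "(B, V) = (\<Sum>i\<in>{0,1,2}. c i *\<^sub>R s i)"
    by blast
  obtain r1 y1 where s0: "s 0 = (- 3 * r1, - 3 * y1)" and r1: "0 \<le> r1" "r1 \<le> 1/3" "F r1 \<le> y1"
    using s by (auto simp: C_def E_def epigraph_def)
  obtain r2 y2 where s1: "s 1 = (1 - 2 * r2, F 1 - 2 * y2)" and r2: "0 \<le> r2" "r2 \<le> 1" "F r2 \<le> y2"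
    using s by (auto simp: C_def E_def epigraph_def)
  obtain y3 where s2: "s 2 = (3, y3)" and y3: "y3 \<le> 3 * F 1"
    using s by (auto simp: C_def)
  have B: "B = c 0 * (- 3 * r1) + c 1 * (1 - 2 * r2) + c 2 * 3"
    and V: "V = c 0 * (- 3 * y1) + c 1 * (F 1 - 2 * y2) + c 2 * y3"
    using BV by (simp_all add: s0 s1[simplified] s2)
  have "V \<le> c 0 * (- 3 * F r1) + c 1 * (F 1 - 2 * F r2) + c 2 * (3 * F 1)"
    unfolding V by (intro add_mono; rule mult_left_mono) (use c r1 r2 y3 in auto)
  then have "hard_form F B V"
    using c by (intro hard_form_mixture[OF F, of "c 0" "c 1" "c 2" r1 r2] B r1 r2) (auto simp: add_ac)
  then show ?thesis by (simp add: B_def V_def)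
qed

text \<open>Completeness depends only on the expected bias sum, and performance is a decreasing
  affine function of the expected value, so each alternative of \<open>hard_form\<close> is realized
  by a two-point distribution.\<close>

lemma hardest_distributions_of_convex:
  fixes F :: "real \<Rightarrow> real" and D :: "triple pmf"
  assumes F: "convex_on {0..1} F" and odd: "\<And>r. F (- r) = - F r" and D: "fin_dist_on_P D"
  shows "\<exists>D'. fin_dist_on_P D' \<and> completeness D' = completeness D \<and>
     measure_pmf.expectation D' (\<lambda>(a, b, c). (3 - F a - F b - F c) / 4)
       \<le> measure_pmf.expectation D (\<lambda>(a, b, c). (3 - F a - F b - F c) / 4) \<and>
     ((\<exists>\<rho>\<in>{0..1/3}. set_pmf D' \<subseteq> {(-\<rho>, -\<rho>, -\<rho>), (-\<rho>, -\<rho>, 1)}) \<or>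
      (\<exists>\<rho>\<in>{1/3..1}. set_pmf D' \<subseteq> {(-1/3, -1/3, -1/3), (-\<rho>, -\<rho>, 1)}) \<or>
      (\<exists>\<rho>\<in>{-1..1}. set_pmf D' \<subseteq> {(-\<rho>, -\<rho>, 1), (1, 1, 1)}))"
proof -
  \<comment> \<open>Used with the identity for completeness and with \<open>F\<close> for
    performance.\<close>
  have affine: "measure_pmf.expectation D' (\<lambda>(a, b, c). (3 - G a - G b - G c) / 4)
      = (3 - measure_pmf.expectation D' (\<lambda>(a, b, c). G a + G b + G c)) / 4"
    if "finite (set_pmf D')" for G :: "real \<Rightarrow> real" and D' :: "triple pmf"
  proof -
    have eq: "(\<lambda>(a, b, c). (3 - G a - G b - G c) / 4) = (\<lambda>x. (3 - (case x of (a, b, c) \<Rightarrow> G a + G b + G c)) / 4)"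
      by (auto simp: fun_eq_iff)
    show ?thesis
      unfolding eq by (simp add: integrable_measure_pmf_finite[OF that])
  qed
  define B where "B = measure_pmf.expectation D (\<lambda>(a, b, c). a + b + c)"
  define V where "V = measure_pmf.expectation D (\<lambda>(a, b, c). F a + F b + F c)"
  have fin: "finite (set_pmf D)" using D by (simp add: fin_dist_on_P_def)
  have Fm: "F (- 1 / 3) = - F (1 / 3)" using odd[of "1/3"] by simp
  let ?good = "\<lambda>D'. fin_dist_on_P D' \<and> completeness D' = completeness D \<and>
     measure_pmf.expectation D' (\<lambda>(a, b, c). (3 - F a - F b - F c) / 4)
       \<le> measure_pmf.expectation D (\<lambda>(a, b, c). (3 - F a - F b - F c) / 4)"
  have ex: "\<exists>D'. ?good D' \<and> set_pmf D' \<subseteq> {X, Y}"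
    if p: "p \<in> {0..1}" and XY: "X \<in> biasP" "Y \<in> biasP"
      and B: "B = p * (case X of (a, b, c) \<Rightarrow> a + b + c) + (1 - p) * (case Y of (a, b, c) \<Rightarrow> a + b + c)"
      and V: "V \<le> p * (case X of (a, b, c) \<Rightarrow> F a + F b + F c) + (1 - p) * (case Y of (a, b, c) \<Rightarrow> F a + F b + F c)"
    for p X Y
  proof -
    obtain D' where D': "set_pmf D' \<subseteq> {X, Y}"
      "\<And>h :: triple \<Rightarrow> real. measure_pmf.expectation D' h = p * h X + (1 - p) * h Y"
      by (rule exists_two_point_pmf[OF p, of X Y]) (rule that)
    have fin': "finite (set_pmf D')" using D'(1) finite_subset by blast
    have "fin_dist_on_P D'" using fin' D'(1) XY by (auto simp: fin_dist_on_P_def)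
    moreover have "completeness D' = completeness D"
      unfolding completeness_def affine[OF fin, of "\<lambda>x. x"] affine[OF fin', of "\<lambda>x. x"]
      using B by (simp add: D'(2) B_def[symmetric])
    moreover have "measure_pmf.expectation D' (\<lambda>(a, b, c). (3 - F a - F b - F c) / 4)
       \<le> measure_pmf.expectation D (\<lambda>(a, b, c). (3 - F a - F b - F c) / 4)"
      unfolding affine[OF fin, of F] affine[OF fin', of F] using V by (simp add: D'(2) V_def[symmetric])
    ultimately show ?thesis using D'(1) by blast
  qed
  have "hard_form F B V" using hard_form_expectation[OF F odd D] by (simp add: B_def V_def)
  then obtain p where p: "p \<in> {0..1}" and cases:
    "(\<exists>r\<in>{0..1/3}. B = p * (- 3 * r) + (1 - p) * (1 - 2 * r) \<and>
        V \<le> p * (- 3 * F r) + (1 - p) * (F 1 - 2 * F r)) \<or>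
     (\<exists>r\<in>{1/3..1}. B = p * (- 1) + (1 - p) * (1 - 2 * r) \<and>
        V \<le> p * (- 3 * F (1/3)) + (1 - p) * (F 1 - 2 * F r)) \<or>
     (\<exists>r\<in>{-1..1}. B = p * (1 - 2 * r) + (1 - p) * 3 \<and>
        V \<le> p * (F 1 - 2 * F r) + (1 - p) * (3 * F 1))"
    unfolding hard_form_def by blast
  from cases show ?thesis
  proof (elim disjE bexE conjE)
    fix r assume r: "r \<in> {0..1/3::real}" and B: "B = p * (- 3 * r) + (1 - p) * (1 - 2 * r)"
      and V: "V \<le> p * (- 3 * F r) + (1 - p) * (F 1 - 2 * F r)"
    have "\<exists>D'. ?good D' \<and> set_pmf D' \<subseteq> {(-r, -r, -r), (-r, -r, 1)}"
      by (rule ex[OF p]) (use r B V in \<open>auto simp: biasP_def odd\<close>)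
    then show ?thesis using r by blast
  next
    fix r assume r: "r \<in> {1/3..1::real}" and B: "B = p * (- 1) + (1 - p) * (1 - 2 * r)"
      and V: "V \<le> p * (- 3 * F (1/3)) + (1 - p) * (F 1 - 2 * F r)"
    have "\<exists>D'. ?good D' \<and> set_pmf D' \<subseteq> {(-1/3, -1/3, -1/3), (-r, -r, 1)}"
      by (rule ex[OF p]) (use r B V in \<open>auto simp: biasP_def odd Fm\<close>)
    then show ?thesis using r by blast
  next
    fix r assume r: "r \<in> {-1..1::real}" and B: "B = p * (1 - 2 * r) + (1 - p) * 3"
      and V: "V \<le> p * (F 1 - 2 * F r) + (1 - p) * (3 * F 1)"
    have "\<exists>D'. ?good D' \<and> set_pmf D' \<subseteq> {(-r, -r, 1), (1, 1, 1)}"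
      by (rule ex[OF p]) (use r B V in \<open>auto simp: biasP_def odd\<close>)
    then show ?thesis using r by blast
  qed
qed

theorem mainTheorem11:
  fixes f :: "real ^ 'd::finite \<Rightarrow> real" and D :: "triple pmf"
  assumes meas: "f \<in> borel_measurable borel"
    and range: "\<And>x. f x \<in> {-1..1}"
    and odd: "\<And>x. f (- x) = - f x"
    and D: "fin_dist_on_P D"
  shows "\<exists>D'. fin_dist_on_P D' \<and> completeness D' = completeness D \<and> s3 f D' \<le> s3 f D \<and>
     ((\<exists>\<rho>\<in>{0..1/3}. set_pmf D' \<subseteq> {(-\<rho>, -\<rho>, -\<rho>), (-\<rho>, -\<rho>, 1)}) \<or>
      (\<exists>\<rho>\<in>{1/3..1}. set_pmf D' \<subseteq> {(-1/3, -1/3, -1/3), (-\<rho>, -\<rho>, 1)}) \<or>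
      (\<exists>\<rho>\<in>{-1..1}. set_pmf D' \<subseteq> {(-\<rho>, -\<rho>, 1), (1, 1, 1)}))"
proof -
  have bound: "\<bar>f x\<bar> \<le> 1" for x using range[of x] by (simp add: abs_le_iff)
  show ?thesis
    unfolding s3_def
    by (rule hardest_distributions_of_convex[OF convex_F2[OF meas bound] F2_uminus[OF meas bound odd] D])
qed

end
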